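(* If $A\subset\mathbb{Z}_+$ possesses a natural density, then the local URI-density of $A$ exists and coincides with its natural density.
   Context: $\mathbb{Z}_+$ denotes the set of positive integers. A set $A\subset\mathbb{Z}_+$ has natural density $\alpha$ if $\frac1n\sum_{j=1}^n\mathbf{1}_A(j)\to\alpha$ as $n\to\infty$, where $\mathbf{1}_A$ is the indicator function of $A$. A URI-set is a random set $\mathbf{E}$ of positive integers such that each integer $n\ge1$ belongs to $\mathbf{E}$ with probability $1/n$, the events $(n\in\mathbf{E})$, $n\ge1$, being independent. Almost surely $\mathbf{E}$ is infinite, and its ordered elements are denoted $N_1=1<N_2<\cdots<N_k<\cdots$. The local URI-density of $A\subset\mathbb{Z}_+$ is the limit of $\mathbb{P}(N_k\in A)$ as $k\to\infty$, whenever this limit exists. *)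

theory Defs
  imports "HOL-Probability.Probability"
begin

definition has_natural_density :: "nat set \<Rightarrow> real \<Rightarrow> bool" where
  "has_natural_density A \<alpha> \<longleftrightarrow>
     (\<lambda>n. 1 / real n * (\<Sum>j=1..n. indicator A j)) \<longlonglongrightarrow> \<alpha>"

locale uri_set = prob_space M for M :: "'a measure" +
  fixes E :: "'a \<Rightarrow> nat set"
  assumes E_pos: "\<And>\<omega>. \<omega> \<in> space M \<Longrightarrow> E \<omega> \<subseteq> {1..}"
    and E_indep: "indep_events (\<lambda>n. {\<omega> \<in> space M. n \<in> E \<omega>}) {1..}"
    and E_prob: "\<And>n. n \<ge> 1 \<Longrightarrow> prob {\<omega> \<in> space M. n \<in> E \<omega>} = 1 / real n"

text \<open>
  The elements are numbered from 1, whereas \<open>enumerate\<close> counts from 0. The value is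
  meaningful if \<open>E \<omega>\<close> is infinite, which for a URI-set holds almost surely; on the
  exceptional null set it is an arbitrary value, which does not affect the probabilities
  below. The index \<open>k = 0\<close> carries no meaning and is irrelevant for limits.
\<close>
definition uri_element :: "('a \<Rightarrow> nat set) \<Rightarrow> nat \<Rightarrow> 'a \<Rightarrow> nat" where
  "uri_element E k \<omega> = enumerate (E \<omega>) (k - 1)"

definition has_local_uri_density ::
    "'a measure \<Rightarrow> ('a \<Rightarrow> nat set) \<Rightarrow> nat set \<Rightarrow> real \<Rightarrow> bool" where
  "has_local_uri_density M E A \<alpha> \<longleftrightarrow>
     (\<lambda>k. measure M {\<omega> \<in> space M. uri_element E k \<omega> \<in> A}) \<longlonglongrightarrow> \<alpha>"

end

theory Submission
  imports Defs
begin

text \<open>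
  Ranks are counted from 0. Write \<open>q\<^sub>j(n)\<close> for the probability that \<open>n\<close> is the element of
  rank \<open>j\<close> and \<open>u\<^sub>j(n)\<close> for the probability that \<open>j\<close> elements lie below \<open>n\<close>.
  Membership of \<open>n\<close> is independent of what happens below \<open>n\<close>, so \<open>n q\<^sub>j(n) = u\<^sub>j(n)\<close>
  (\<open>rank_law_eq\<close>). When \<open>n\<close> is passed, the count leaves the value \<open>j\<close> with probability
  \<open>q\<^sub>j(n)\<close> and enters it with probability \<open>q\<^bsub>j-1\<^esub>(n)\<close> (\<open>count_law_Suc\<close>). Hence
  \<open>n (q\<^sub>j(n) - q\<^sub>j(n+1)) = u\<^sub>j(n) - u\<^sub>j(n+1) + q\<^sub>j(n+1) = q\<^sub>j(n) - q\<^bsub>j-1\<^esub>(n) + q\<^sub>j(n+1)\<close>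
  for all \<open>j, n \<ge> 1\<close>. The three terms on the right, summed over \<open>n\<close>, contribute at most 1
  each in absolute value, so that \<open>\<Sum>n. n \<bar>q\<^sub>j(n) - q\<^sub>j(n+1)\<bar> \<le> 3\<close> uniformly in \<open>j\<close>
  (\<open>rank_law_variation\<close>). The rest is deterministic: summation by parts turns
  \<open>\<Sum>n. q\<^sub>j(n) (1\<^sub>A(n) - \<alpha>)\<close> into an average of the deviations
  \<open>\<bar>A \<inter> {1..n}\<bar> / n - \<alpha>\<close> against the signed weights \<open>n (q\<^sub>j(n) - q\<^sub>j(n+1))\<close>. The
  deviations tend to 0 as \<open>n\<close> grows, the weights have bounded total mass, and their mass on any
  bounded range of \<open>n\<close> disappears as \<open>j\<close> grows (\<open>natural_density_weighted_average\<close>).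

  It remains to see that \<open>q\<^sub>j\<close> is a full probability distribution, that is, that an element of
  rank \<open>j\<close> exists almost surely (\<open>rank_law_sums_1\<close>). By the recursion, \<open>u\<^sub>j(n)\<close> has a limit
  as \<open>n\<close> grows, namely \<open>\<Sum>n. q\<^bsub>j-1\<^esub>(n) - q\<^sub>j(n)\<close>. If it were positive, then
  \<open>q\<^sub>j(n) = u\<^sub>j(n) / n\<close> would have an infinite sum.
\<close>

section \<open>Averaging along weights of bounded weighted variation\<close>

lemma summation_by_parts_initial_sums:
  fixes p g :: "nat \<Rightarrow> real"
  shows "(\<Sum>n=1..N. p n * g n)
    = p (Suc N) * (\<Sum>i=1..N. g i) + (\<Sum>n=1..N. (\<Sum>i=1..n. g i) * (p n - p (Suc n)))"
  by (induction N) (simp_all add: algebra_simps)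

text \<open>
  The deviations of the densities of initial segments from \<open>\<alpha>\<close> are averaged against the
  signed weights \<open>n (q\<^sub>j(n) - q\<^sub>j(n+1))\<close>, as in the Silverman-Toeplitz theorem. The bound
  on \<open>n q\<^sub>j(n)\<close> controls the boundary term of the summation by parts.
\<close>
lemma natural_density_weighted_average:
  fixes q :: "nat \<Rightarrow> nat \<Rightarrow> real"
  assumes dens: "has_natural_density A \<alpha>"
    and q_at_0: "\<And>j. q j 0 = 0"
    and q_nonneg: "\<And>j n. 0 \<le> q j n"
    and q_sums: "\<And>j. q j sums 1"
    and q_lim: "\<And>n. (\<lambda>j. q j n) \<longlonglongrightarrow> 0"
    and q_bound: "\<And>j n. real n * q j n \<le> 1"
    and q_variation: "\<And>j N. (\<Sum>n=1..N. real n * \<bar>q j n - q j (Suc n)\<bar>) \<le> C"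
  shows "(\<lambda>j. \<Sum>n. q j n * indicator A n) \<longlonglongrightarrow> \<alpha>"
proof (rule LIMSEQ_I)
  fix r :: real
  assume "0 < r"
  have C: "0 \<le> C" using q_variation[of 0 0] by simp
  \<comment> \<open>The final estimate is \<open>(C + 2) * e\<close>: one \<open>e\<close> for the boundary term, one for the
    indices up to \<open>m\<close>, and \<open>C * e\<close> for the rest; the constant 3 makes it strict.\<close>
  define e where "e = r / (C + 3)"
  have e: "0 < e" "(C + 3) * e = r"
    using \<open>0 < r\<close> C by (auto simp: e_def)
  define D where "D n = (\<Sum>i=1..n. indicator A i - \<alpha>)" for n :: nat
  obtain m where m: "\<And>n. n \<ge> m \<Longrightarrow> \<bar>1 / real n * (\<Sum>j=1..n. indicator A j) - \<alpha>\<bar> < e"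
    using LIMSEQ_D[OF dens[unfolded has_natural_density_def] e(1)] by auto
  have D: "\<bar>D n\<bar> \<le> e * real n" if "n \<ge> m" for n
  proof (cases "n = 0")
    case False
    have "D n = real n * (1 / real n * (\<Sum>j=1..n. indicator A j) - \<alpha>)"
      using False by (simp add: D_def sum_subtractf algebra_simps)
    then show ?thesis
      using m[OF that] False
      by (simp add: abs_mult mult.commute[of e] mult_left_mono less_imp_le)
  qed (simp add: D_def)
  have "(\<lambda>j. \<Sum>n=1..m. \<bar>D n\<bar> * \<bar>q j n - q j (Suc n)\<bar>) \<longlonglongrightarrow> (\<Sum>n=1..m. \<bar>D n\<bar> * \<bar>0 - 0\<bar>)"
    by (intro tendsto_intros q_lim)
  then have "(\<lambda>j. \<Sum>n=1..m. \<bar>D n\<bar> * \<bar>q j n - q j (Suc n)\<bar>) \<longlonglongrightarrow> 0"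
    by simp
  from order_tendstoD(2)[OF this e(1)] obtain J where
    J: "\<And>j. j \<ge> J \<Longrightarrow> (\<Sum>n=1..m. \<bar>D n\<bar> * \<bar>q j n - q j (Suc n)\<bar>) < e"
    by (auto simp: eventually_sequentially)
  show "\<exists>no. \<forall>j\<ge>no. norm ((\<Sum>n. q j n * indicator A n) - \<alpha>) < r"
  proof (intro exI[of _ J] allI impI)
    fix j assume j: "J \<le> j"
    \<comment> \<open>Stated for partial sums, where the boundary term is present and is at most \<open>e\<close>.\<close>
    have partial: "\<bar>\<Sum>n=1..N. q j n * (indicator A n - \<alpha>)\<bar> \<le> e + (e + e * C)"
      if N: "N \<ge> m" for N
    proof -
      have "\<bar>q j (Suc N) * D N\<bar> \<le> q j (Suc N) * (e * real N)"
        using D[OF N] q_nonneg by (simp add: abs_mult mult_left_mono)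
      also have "\<dots> \<le> e * (real (Suc N) * q j (Suc N))"
        using e(1) q_nonneg[of j "Suc N"] by (simp add: algebra_simps)
      also have "\<dots> \<le> e"
        using q_bound[of "Suc N" j] e(1) by (simp add: mult_le_cancel_left1 del: of_nat_Suc)
      finally have boundary: "\<bar>q j (Suc N) * D N\<bar> \<le> e" .
      have "\<bar>\<Sum>n=1..N. D n * (q j n - q j (Suc n))\<bar> \<le> (\<Sum>n=1..N. \<bar>D n\<bar> * \<bar>q j n - q j (Suc n)\<bar>)"
        by (rule order_trans[OF sum_abs]) (simp add: abs_mult)
      also have "\<dots> = (\<Sum>n=1..m. \<bar>D n\<bar> * \<bar>q j n - q j (Suc n)\<bar>)
          + (\<Sum>n=Suc m..N. \<bar>D n\<bar> * \<bar>q j n - q j (Suc n)\<bar>)"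
        using N by (subst sum.union_disjoint[symmetric])
          (auto intro!: sum.cong)
      also have "(\<Sum>n=Suc m..N. \<bar>D n\<bar> * \<bar>q j n - q j (Suc n)\<bar>)
          \<le> (\<Sum>n=Suc m..N. e * (real n * \<bar>q j n - q j (Suc n)\<bar>))"
        using D by (intro sum_mono) (simp add: mult.assoc[symmetric] mult_right_mono)
      also have "\<dots> \<le> (\<Sum>n=1..N. e * (real n * \<bar>q j n - q j (Suc n)\<bar>))"
        using e(1) by (intro sum_mono2) auto
      also have "\<dots> \<le> e * C"
        using q_variation[of j N] e(1) by (simp add: sum_distrib_left[symmetric])
      finally have "\<bar>\<Sum>n=1..N. D n * (q j n - q j (Suc n))\<bar> \<le> e + e * C"
        using J[OF j] by simp
      moreover have "(\<Sum>n=1..N. q j n * (indicator A n - \<alpha>))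
          = q j (Suc N) * D N + (\<Sum>n=1..N. D n * (q j n - q j (Suc n)))"
        unfolding D_def by (rule summation_by_parts_initial_sums)
      ultimately show ?thesis
        using boundary by linarith
    qed
    have summ: "summable (\<lambda>n. q j n * indicator A n)"
      by (rule summable_comparison_test[OF _ sums_summable[OF q_sums[of j]]])
        (auto simp: q_nonneg indicator_def)
    have "(\<lambda>n. q j n * indicator A n - q j n * \<alpha>) sums ((\<Sum>n. q j n * indicator A n) - 1 * \<alpha>)"
      by (intro sums_diff sums_mult2 q_sums summable_sums summ)
    then have "(\<lambda>N. \<Sum>n\<le>N. q j n * (indicator A n - \<alpha>)) \<longlonglongrightarrow> (\<Sum>n. q j n * indicator A n) - \<alpha>"
      by (simp add: sums_def_le right_diff_distrib)
    moreover have "(\<Sum>n\<le>N. q j n * (indicator A n - \<alpha>)) = (\<Sum>n=1..N. q j n * (indicator A n - \<alpha>))" for N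
      by (rule sum.mono_neutral_right) (auto simp: q_at_0 Suc_le_eq)
    ultimately have "(\<lambda>N. \<Sum>n=1..N. q j n * (indicator A n - \<alpha>)) \<longlonglongrightarrow> (\<Sum>n. q j n * indicator A n) - \<alpha>"
      by simp
    from tendsto_rabs[OF this] have "\<bar>(\<Sum>n. q j n * indicator A n) - \<alpha>\<bar> \<le> e + (e + e * C)"
      by (rule LIMSEQ_le_const2) (use partial in blast)
    then show "norm ((\<Sum>n. q j n * indicator A n) - \<alpha>) < r"
      using e by (simp add: algebra_simps)
  qed
qed

section \<open>Enumeration and counting\<close>

text \<open>
  The set may be finite: if \<open>n\<close> is a member with \<open>j\<close> members below it, then removing the minimum
  \<open>j\<close> times never exhausts the set.
\<close>
lemma enumerate_eq_if_card_below:
  fixes S :: "nat set"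
  assumes "n \<in> S" "card (S \<inter> {..<n}) = j"
  shows "enumerate S j = n"
  using assms
proof (induction j arbitrary: S)
  case 0
  then have "S \<inter> {..<n} = {}" by simp
  then have "(LEAST m. m \<in> S) = n"
    using 0 by (intro Least_equality) (auto simp: not_less[symmetric])
  then show ?case by (simp add: enumerate_0)
next
  case (Suc j)
  define m where "m = (LEAST m. m \<in> S)"
  have "S \<inter> {..<n} \<noteq> {}" using Suc.prems by auto
  then obtain i where "i \<in> S" "i < n" by auto
  then have m: "m \<in> S" "m < n"
    unfolding m_def using LeastI[of "\<lambda>m. m \<in> S" i] Least_le[of "\<lambda>m. m \<in> S" i] by auto
  have "(S - {m}) \<inter> {..<n} = S \<inter> {..<n} - {m}" by auto
  then have "card ((S - {m}) \<inter> {..<n}) = j" using m Suc.prems by simp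
  then have "enumerate (S - {m}) j = n" using m Suc by auto
  then show ?case by (simp add: enumerate_Suc m_def)
qed

lemma measurable_enumerate:
  fixes S :: "'a \<Rightarrow> nat set"
  assumes "\<And>n. Measurable.pred M (\<lambda>\<omega>. n \<in> S \<omega>)"
  shows "(\<lambda>\<omega>. enumerate (S \<omega>) j) \<in> measurable M (count_space UNIV)"
  using assms
proof (induction j arbitrary: S)
  case 0
  note [measurable] = 0
  show ?case unfolding enumerate_0 by measurable
next
  case (Suc j)
  note [measurable] = Suc.prems
  have "(\<lambda>\<omega>. enumerate (S \<omega> - {LEAST n. n \<in> S \<omega>}) j) \<in> measurable M (count_space UNIV)"
    by (rule Suc.IH) (simp, measurable)
  then show ?case by (simp add: enumerate_Suc)
qed

lemma card_Int_lessThan_Suc: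
  "card (S \<inter> {..<Suc n}) = (if n \<in> S then Suc (card (S \<inter> {..<n})) else card (S \<inter> {..<n}))"
  by (simp add: lessThan_Suc)

section \<open>The law of the ordered elements of a URI-set\<close>

context uri_set
begin

definition count_law :: "nat \<Rightarrow> nat \<Rightarrow> real" where
  "count_law j n = prob {\<omega> \<in> space M. card (E \<omega> \<inter> {..<n}) = j}"

definition rank_law :: "nat \<Rightarrow> nat \<Rightarrow> real" where
  "rank_law j n = prob {\<omega> \<in> space M. n \<in> E \<omega> \<and> card (E \<omega> \<inter> {..<n}) = j}"

text \<open>The number 0 is not covered by the independence hypothesis, but it never belongs to the set.\<close>
lemma pred_mem_E [measurable]: "Measurable.pred M (\<lambda>\<omega>. n \<in> E \<omega>)"
proof (cases "n \<ge> 1")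
  case True
  then show ?thesis
    using E_indep unfolding indep_events_def pred_def by auto
next
  case False
  have "Measurable.pred M (\<lambda>\<omega>. False)" by simp
  also have "?this \<longleftrightarrow> ?thesis"
    using E_pos False by (intro measurable_cong) auto
  finally show ?thesis .
qed

lemma pred_card_E [measurable]: "Measurable.pred M (\<lambda>\<omega>. card (E \<omega> \<inter> {..<n}) = j)"
proof (induction n arbitrary: j)
  case (Suc n)
  note [measurable] = Suc
  have "(card (E \<omega> \<inter> {..<Suc n}) = j) \<longleftrightarrow>
      (n \<in> E \<omega> \<and> j \<noteq> 0 \<and> card (E \<omega> \<inter> {..<n}) = j - 1) \<or>
      (n \<notin> E \<omega> \<and> card (E \<omega> \<inter> {..<n}) = j)" for \<omega>
    by (auto simp: card_Int_lessThan_Suc)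
  then show ?case by simp
qed simp

lemma pattern_event:
  assumes "finite T" "finite F"
  shows "{\<omega> \<in> space M. T \<subseteq> E \<omega> \<and> F \<inter> E \<omega> = {}} \<in> events"
proof -
  have "Measurable.pred M (\<lambda>\<omega>. (\<forall>i\<in>T. i \<in> E \<omega>) \<and> (\<forall>i\<in>F. i \<notin> E \<omega>))"
    using assms by measurable
  moreover have "(T \<subseteq> E \<omega> \<and> F \<inter> E \<omega> = {}) \<longleftrightarrow> (\<forall>i\<in>T. i \<in> E \<omega>) \<and> (\<forall>i\<in>F. i \<notin> E \<omega>)" for \<omega>
    by blast
  ultimately show ?thesis by (simp add: pred_def)
qed

text \<open>
  Independence is given for membership only. Prescribed non-members are introduced one at a time:
  the event that \<open>x\<close> is absent is the difference of the event without a condition on \<open>x\<close> and the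
  event that \<open>x\<close> is present, and \<open>n\<close> splits off as a factor \<open>1 / n\<close> from both of these.
\<close>
lemma prob_pattern_insert:
  assumes "finite T" "finite F" "T \<subseteq> {1..}" "F \<subseteq> {1..}" "n \<ge> 1" "n \<notin> T" "n \<notin> F"
  shows "prob {\<omega> \<in> space M. insert n T \<subseteq> E \<omega> \<and> F \<inter> E \<omega> = {}}
    = 1 / real n * prob {\<omega> \<in> space M. T \<subseteq> E \<omega> \<and> F \<inter> E \<omega> = {}}"
  using assms(2,1,3-)
proof (induction F arbitrary: T rule: finite_induct)
  case empty
  have *: "prob {\<omega> \<in> space M. T \<subseteq> E \<omega>} = (\<Prod>i\<in>T. 1 / real i)"
    if "finite T" "T \<subseteq> {1..}" for T
  proof (cases "T = {}")
    case False
    have "{\<omega> \<in> space M. T \<subseteq> E \<omega>} = (\<Inter>i\<in>T. {\<omega> \<in> space M. i \<in> E \<omega>})"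
      using False by auto
    also have "prob \<dots> = (\<Prod>i\<in>T. prob {\<omega> \<in> space M. i \<in> E \<omega>})"
      using E_indep that False unfolding indep_events_def by blast
    also have "\<dots> = (\<Prod>i\<in>T. 1 / real i)"
      using that by (intro prod.cong) (auto simp: E_prob)
    finally show ?thesis .
  qed (simp add: prob_space)
  show ?case using *[of T] *[of "insert n T"] empty by simp
next
  case (insert x F)
  have fin: "finite T" "finite F" by fact+
  have *: "prob {\<omega> \<in> space M. T \<subseteq> E \<omega> \<and> insert x F \<inter> E \<omega> = {}}
    = prob {\<omega> \<in> space M. T \<subseteq> E \<omega> \<and> F \<inter> E \<omega> = {}}
    - prob {\<omega> \<in> space M. insert x T \<subseteq> E \<omega> \<and> F \<inter> E \<omega> = {}}"
    if "finite T" for T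
  proof -
    have "{\<omega> \<in> space M. T \<subseteq> E \<omega> \<and> insert x F \<inter> E \<omega> = {}}
      = {\<omega> \<in> space M. T \<subseteq> E \<omega> \<and> F \<inter> E \<omega> = {}}
      - {\<omega> \<in> space M. insert x T \<subseteq> E \<omega> \<and> F \<inter> E \<omega> = {}}"
      by auto
    then show ?thesis
      using pattern_event[of T F] pattern_event[of "insert x T" F] that fin
      by (simp only:) (intro finite_measure_Diff, auto)
  qed
  show ?case
    using *[of T] *[of "insert n T"] insert.IH[of T] insert.IH[of "insert x T"] insert.prems
    by (simp add: insert_commute[of x n] right_diff_distrib)
qed

text \<open>
  Membership of \<open>n\<close> is independent of the trace of the set on \<open>{1..<n}\<close>; sum over all traces
  of size \<open>j\<close>. At \<open>n = 0\<close> both sides vanish, the right one because division by 0 gives 0.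
\<close>
lemma rank_law_eq: "rank_law j n = count_law j n / real n"
proof (cases "n = 0")
  case True
  have "{\<omega> \<in> space M. n \<in> E \<omega> \<and> card (E \<omega> \<inter> {..<n}) = j} = {}"
    using E_pos True by fastforce
  then show ?thesis unfolding rank_law_def using True by (simp only: measure_empty) simp
next
  case False
  define \<T> where "\<T> = {T. T \<subseteq> {1..<n} \<and> card T = j}"
  define G where "G R T = {\<omega> \<in> space M. R \<union> T \<subseteq> E \<omega> \<and> ({1..<n} - T) \<inter> E \<omega> = {}}" for R T
  have fin: "finite \<T>" by (simp add: \<T>_def)
  have \<T>: "T \<subseteq> {1..<n}" "finite T" if "T \<in> \<T>" for T
    using that finite_subset[of T "{1..<n}"] by (auto simp: \<T>_def)
  have trace: "(T \<subseteq> E \<omega> \<and> ({1..<n} - T) \<inter> E \<omega> = {}) \<longleftrightarrow> E \<omega> \<inter> {..<n} = T"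
    if "\<omega> \<in> space M" "T \<in> \<T>" for \<omega> T
  proof -
    have "E \<omega> \<inter> {..<n} = E \<omega> \<inter> {1..<n}" using E_pos[OF that(1)] by auto
    then show ?thesis using \<T>(1)[OF that(2)] by blast
  qed
  \<comment> \<open>Used with \<open>R = {n}\<close> for the rank and with \<open>R = {}\<close> for the count.\<close>
  have decompose: "prob {\<omega> \<in> space M. R \<subseteq> E \<omega> \<and> card (E \<omega> \<inter> {..<n}) = j} = (\<Sum>T\<in>\<T>. prob (G R T))"
    if R: "finite R" for R
  proof -
    have G: "G R T = {\<omega> \<in> space M. R \<subseteq> E \<omega> \<and> E \<omega> \<inter> {..<n} = T}" if "T \<in> \<T>" for T
      using trace[OF _ that] by (auto simp: G_def)
    have "{\<omega> \<in> space M. R \<subseteq> E \<omega> \<and> card (E \<omega> \<inter> {..<n}) = j} = (\<Union>T\<in>\<T>. G R T)"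
    proof -
      have "E \<omega> \<inter> {..<n} \<subseteq> {1..<n}" if "\<omega> \<in> space M" for \<omega>
        using E_pos[OF that] by auto
      then have "E \<omega> \<inter> {..<n} \<in> \<T> \<longleftrightarrow> card (E \<omega> \<inter> {..<n}) = j" if "\<omega> \<in> space M" for \<omega>
        using that by (simp add: \<T>_def)
      then show ?thesis by (auto simp: G)
    qed
    moreover have "G R T \<in> events" if "T \<in> \<T>" for T
      unfolding G_def using R \<T>[OF that] by (intro pattern_event) auto
    moreover have "disjoint_family_on (G R) \<T>"
      by (auto simp: disjoint_family_on_def G)
    ultimately show ?thesis
      using fin by (simp add: finite_measure_finite_Union image_subset_iff)
  qed
  have "prob (G {n} T) = 1 / real n * prob (G {} T)" if "T \<in> \<T>" for T
    using prob_pattern_insert[of T "{1..<n} - T" n] \<T>[OF that] False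
    by (auto simp: G_def subset_iff)
  then show ?thesis
    using decompose[of "{n}"] decompose[of "{}"]
    by (simp add: rank_law_def count_law_def sum_divide_distrib)
qed

lemma count_law_le_1: "count_law j n \<le> 1"
  by (simp add: count_law_def)

lemma rank_law_nonneg: "0 \<le> rank_law j n"
  by (simp add: rank_law_def)

lemma count_law_at_0: "count_law j 0 = (if j = 0 then 1 else 0)"
  by (simp add: count_law_def prob_space)

lemma rank_law_at_0: "rank_law j 0 = 0"
  by (simp add: rank_law_eq)

lemma rank_law_eq_0: "rank_law j n = 0" if "n \<le> j"
proof -
  have "card (E \<omega> \<inter> {..<n}) < j" if "\<omega> \<in> space M" "n \<in> E \<omega>" for \<omega>
  proof -
    have "card (E \<omega> \<inter> {..<n}) \<le> card {1..<n}"
      using E_pos[OF that(1)] by (intro card_mono) auto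
    also have "\<dots> < j" using E_pos that \<open>n \<le> j\<close> by force
    finally show ?thesis .
  qed
  then have "{\<omega> \<in> space M. n \<in> E \<omega> \<and> card (E \<omega> \<inter> {..<n}) = j} = {}"
    by auto
  then show ?thesis unfolding rank_law_def by (simp only: measure_empty)
qed

text \<open>
  The count up to \<open>n\<close> equals \<open>j + 1\<close> if it did so below \<open>n\<close> and \<open>n\<close> is absent, or if it was \<open>j\<close>
  below \<open>n\<close> and \<open>n\<close> is present. This is the recursion of the unsigned Stirling numbers of the
  first kind.
\<close>
lemma count_law_Suc:
  "count_law (Suc j) (Suc n) = count_law (Suc j) n - rank_law (Suc j) n + rank_law j n"
proof -
  let ?C = "\<lambda>i. {\<omega> \<in> space M. card (E \<omega> \<inter> {..<n}) = i}"
  let ?H = "\<lambda>i. {\<omega> \<in> space M. n \<in> E \<omega> \<and> card (E \<omega> \<inter> {..<n}) = i}"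
  have C: "?C i \<in> events" and H: "?H i \<in> events" for i
    by measurable
  have "{\<omega> \<in> space M. card (E \<omega> \<inter> {..<Suc n}) = Suc j} = (?C (Suc j) - ?H (Suc j)) \<union> ?H j"
    by (auto simp: card_Int_lessThan_Suc)
  moreover have "prob ((?C (Suc j) - ?H (Suc j)) \<union> ?H j)
      = prob (?C (Suc j) - ?H (Suc j)) + prob (?H j)"
    using C H by (intro finite_measure_Union sets.Diff) auto
  moreover have "prob (?C (Suc j) - ?H (Suc j)) = prob (?C (Suc j)) - prob (?H (Suc j))"
    using C H by (intro finite_measure_Diff) auto
  ultimately show ?thesis
    unfolding count_law_def rank_law_def by (simp only:)
qed

text \<open>Two different numbers cannot have the same rank, so the events are disjoint in \<open>n\<close>.\<close>
lemma sums_prob_rank: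
  "(\<lambda>n. rank_law j n * indicator B n) sums
     prob {\<omega> \<in> space M. \<exists>n\<in>B. n \<in> E \<omega> \<and> card (E \<omega> \<inter> {..<n}) = j}"
proof -
  define H where "H n = {\<omega> \<in> space M. n \<in> B \<and> n \<in> E \<omega> \<and> card (E \<omega> \<inter> {..<n}) = j}" for n
  have "(\<lambda>n. prob (H n)) sums prob (\<Union>n. H n)"
  proof (rule finite_measure_UNION)
    show "range H \<subseteq> events" by (auto simp: H_def)
    show "disjoint_family H"
      unfolding disjoint_family_on_def
    proof (intro ballI impI equals0I)
      fix m n \<omega> assume "m \<noteq> n" "\<omega> \<in> H m \<inter> H n"
      then show False
        using enumerate_eq_if_card_below[of m "E \<omega>" j] enumerate_eq_if_card_below[of n "E \<omega>" j]
        by (simp add: H_def)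
    qed
  qed
  moreover have "prob (H n) = rank_law j n * indicator B n" for n
    by (simp add: H_def rank_law_def indicator_def)
  moreover have "(\<Union>n. H n) = {\<omega> \<in> space M. \<exists>n\<in>B. n \<in> E \<omega> \<and> card (E \<omega> \<inter> {..<n}) = j}"
    by (auto simp: H_def)
  ultimately show ?thesis by simp
qed

lemma summable_rank_law: "summable (rank_law j)"
  using sums_summable[OF sums_prob_rank[of j UNIV]] by simp

lemma suminf_rank_law_le_1: "suminf (rank_law j) \<le> 1"
  using sums_prob_rank[of j UNIV] by (auto dest!: sums_unique[symmetric])

lemma sum_rank_law_le_1: "finite I \<Longrightarrow> sum (rank_law j) I \<le> 1"
  using sum_le_suminf[OF summable_rank_law] rank_law_nonneg suminf_rank_law_le_1
  by (meson order_trans)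

text \<open>
  Rank 0 always belongs to the element 1. For the step, the recursion telescopes, so the count law
  at rank \<open>j + 1\<close> converges to the mass that the rank law has lost; a positive limit would bound
  the rank law below by a multiple of the harmonic series.
\<close>
lemma rank_law_sums_1: "rank_law j sums 1"
proof (induction j)
  case 0
  have "{\<omega> \<in> space M. card (E \<omega> \<inter> {..<1}) = 0} = space M"
    using E_pos by fastforce
  then have "rank_law 0 1 = 1"
    by (simp add: rank_law_eq count_law_def prob_space)
  then have "1 \<le> suminf (rank_law 0)"
    using sum_le_suminf[OF summable_rank_law, of "{1}" 0] rank_law_nonneg by simp
  then show ?case
    using suminf_rank_law_le_1[of 0] summable_sums[OF summable_rank_law, of 0] by simp
next
  case (Suc j)
  define s where "s = suminf (rank_law (Suc j))"
  have s: "rank_law (Suc j) sums s"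
    unfolding s_def by (rule summable_sums[OF summable_rank_law])
  have "count_law (Suc j) n = (\<Sum>i<n. rank_law j i - rank_law (Suc j) i)" for n
    by (induction n) (simp_all add: count_law_at_0 count_law_Suc)
  then have "count_law (Suc j) = (\<lambda>n. \<Sum>i<n. rank_law j i - rank_law (Suc j) i)" by blast
  then have lim: "count_law (Suc j) \<longlonglongrightarrow> 1 - s"
    using sums_diff[OF Suc s] by (simp add: sums_def)
  have "s = 1"
  proof (rule ccontr)
    assume "s \<noteq> 1"
    then have L: "0 < 1 - s" using suminf_rank_law_le_1[of "Suc j"] by (simp add: s_def)
    then have "(1 - s) / 2 < 1 - s" by simp
    from order_tendstoD(1)[OF lim this] obtain N where
      N: "\<And>n. n \<ge> N \<Longrightarrow> (1 - s) / 2 < count_law (Suc j) n"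
      by (auto simp: eventually_sequentially)
    have "summable (\<lambda>n. (1 - s) / 2 * inverse (real n))"
    proof (rule summable_comparison_test'[OF summable_rank_law[of "Suc j"]])
      fix n assume "N \<le> n"
      then have "(1 - s) / 2 * inverse (real n) \<le> count_law (Suc j) n * inverse (real n)"
        using N[of n] by (intro mult_right_mono) auto
      then show "norm ((1 - s) / 2 * inverse (real n)) \<le> rank_law (Suc j) n"
        using L unfolding rank_law_eq divide_inverse by simp
    qed
    then have "summable (\<lambda>n. inverse (real n))"
      using L by (subst (asm) summable_cmult_iff) auto
    then show False using not_summable_harmonic[where 'a = real] by simp
  qed
  then show ?case using s by simp
qed

text \<open>
  Multiplying by \<open>n\<close> turns the rank law into the count law, whose increments are differences of
  two rank laws; the third summand comes from \<open>n\<close> and \<open>n + 1\<close> being different factors.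
\<close>
lemma rank_law_variation:
  "(\<Sum>n=1..N. real n * \<bar>rank_law (Suc j) n - rank_law (Suc j) (Suc n)\<bar>) \<le> 3"
proof -
  have "real n * \<bar>rank_law (Suc j) n - rank_law (Suc j) (Suc n)\<bar>
      \<le> rank_law (Suc j) n + rank_law j n + rank_law (Suc j) (Suc n)" if "n \<ge> 1" for n
  proof -
    have eq: "real m * rank_law i m = count_law i m" if "m \<ge> 1" for m i
      using that by (simp add: rank_law_eq)
    have "real n * (rank_law (Suc j) n - rank_law (Suc j) (Suc n))
        = rank_law (Suc j) n - rank_law j n + rank_law (Suc j) (Suc n)"
      using eq[OF that, of "Suc j"] eq[of "Suc n" "Suc j"] count_law_Suc[of j n]
      by (simp add: algebra_simps)
    moreover have "real n * \<bar>rank_law (Suc j) n - rank_law (Suc j) (Suc n)\<bar>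
        = \<bar>real n * (rank_law (Suc j) n - rank_law (Suc j) (Suc n))\<bar>"
      by (simp add: abs_mult)
    ultimately show ?thesis
      using rank_law_nonneg[of "Suc j" n] rank_law_nonneg[of j n] rank_law_nonneg[of "Suc j" "Suc n"]
      by linarith
  qed
  then have "(\<Sum>n=1..N. real n * \<bar>rank_law (Suc j) n - rank_law (Suc j) (Suc n)\<bar>)
      \<le> (\<Sum>n=1..N. rank_law (Suc j) n + rank_law j n + rank_law (Suc j) (Suc n))"
    by (intro sum_mono) auto
  also have "\<dots> = (\<Sum>n=1..N. rank_law (Suc j) n) + (\<Sum>n=1..N. rank_law j n)
      + (\<Sum>n=Suc 1..Suc N. rank_law (Suc j) n)"
    by (simp only: sum.distrib sum.shift_bounds_cl_Suc_ivl)
  also have "\<dots> \<le> 3"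
    using sum_rank_law_le_1[of "{1..N}" "Suc j"] sum_rank_law_le_1[of "{1..N}" j]
      sum_rank_law_le_1[of "{Suc 1..Suc N}" "Suc j"] by simp
  finally show ?thesis .
qed

text \<open>
  Almost surely an element of rank \<open>j\<close> exists, and then it is the value of \<^const>\<open>enumerate\<close>.
  So the distribution of this value is the rank law.
\<close>
lemma prob_enumerate_eq_suminf_rank_law:
  "prob {\<omega> \<in> space M. enumerate (E \<omega>) j \<in> A} = (\<Sum>n. rank_law j n * indicator A n)"
proof -
  let ?H = "\<lambda>B. {\<omega> \<in> space M. \<exists>n\<in>B. n \<in> E \<omega> \<and> card (E \<omega> \<inter> {..<n}) = j}"
  have meas [measurable]: "(\<lambda>\<omega>. enumerate (E \<omega>) j) \<in> measurable M (count_space UNIV)"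
    by (rule measurable_enumerate) measurable
  have "prob (?H UNIV) = 1"
    using sums_unique2[OF sums_prob_rank[of j UNIV]] rank_law_sums_1[of j] by simp
  then have "AE \<omega> in M. \<omega> \<in> ?H UNIV"
    by (subst (asm) prob_eq_1) auto
  then have "prob {\<omega> \<in> space M. enumerate (E \<omega>) j \<in> A} = prob (?H A)"
  proof (intro finite_measure_eq_AE)
    show "AE \<omega> in M. \<omega> \<in> {\<omega> \<in> space M. enumerate (E \<omega>) j \<in> A} \<longleftrightarrow> \<omega> \<in> ?H A"
      using \<open>AE \<omega> in M. \<omega> \<in> ?H UNIV\<close>
    proof (rule eventually_mono)
      fix \<omega> assume "\<omega> \<in> ?H UNIV"
      then obtain n where n: "\<omega> \<in> space M" "n \<in> E \<omega>" "card (E \<omega> \<inter> {..<n}) = j" by blast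
      have "(\<exists>m\<in>A. m \<in> E \<omega> \<and> card (E \<omega> \<inter> {..<m}) = j) \<longleftrightarrow> n \<in> A"
        using n(2,3) enumerate_eq_if_card_below[OF n(2,3)] enumerate_eq_if_card_below[of _ "E \<omega>" j]
        by metis
      then show "\<omega> \<in> {\<omega> \<in> space M. enumerate (E \<omega>) j \<in> A} \<longleftrightarrow> \<omega> \<in> ?H A"
        using n(1) enumerate_eq_if_card_below[OF n(2,3)] by simp
    qed
  qed auto
  also have "\<dots> = (\<Sum>n. rank_law j n * indicator A n)"
    by (rule sums_unique[OF sums_prob_rank])
  finally show ?thesis .
qed

lemma local_uri_density_if_natural_density:
  assumes "has_natural_density A \<alpha>"
  shows "has_local_uri_density M E A \<alpha>"
proof -
  have "(\<lambda>j. \<Sum>n. rank_law (Suc j) n * indicator A n) \<longlonglongrightarrow> \<alpha>"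
  proof (rule natural_density_weighted_average[OF assms, where C = 3])
    show "(\<lambda>j. rank_law (Suc j) n) \<longlonglongrightarrow> 0" for n
      by (rule tendsto_eventually)
        (auto simp: eventually_sequentially intro!: exI[of _ n] rank_law_eq_0)
    show "real n * rank_law (Suc j) n \<le> 1" for j n
      using count_law_le_1 by (cases "n = 0") (simp_all add: rank_law_eq)
  qed (auto simp: rank_law_at_0 rank_law_nonneg rank_law_sums_1 rank_law_variation[simplified])
  \<comment> \<open>The element numbered \<open>j + 2\<close> has rank \<open>j + 1\<close>; the variation bound is for positive ranks.\<close>
  then have "(\<lambda>j. prob {\<omega> \<in> space M. uri_element E (Suc (Suc j)) \<omega> \<in> A}) \<longlonglongrightarrow> \<alpha>"
    by (simp add: uri_element_def prob_enumerate_eq_suminf_rank_law)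
  then show ?thesis
    unfolding has_local_uri_density_def
    by - (rule LIMSEQ_offset[where k = 2], simp add: numeral_2_eq_2)
qed

end

theorem theorem5p2:
  fixes M :: "'a measure" and E :: "'a \<Rightarrow> nat set" and A :: "nat set" and \<alpha> :: real
  assumes "uri_set M E"
    and "A \<subseteq> {1..}"
    and "has_natural_density A \<alpha>"
  shows "has_local_uri_density M E A \<alpha>"
  using uri_set.local_uri_density_if_natural_density[OF assms(1,3)] .

end
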